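(* Let $D\subset\mathbb{R}^n$ be a compact convex domain and let $f$ be a convex and continuous real-valued function over $D$ (not necessarily continuously differentiable). Suppose $f$ is $L$-Lipschitz and $C_f(\epsilon)\le \frac{D_f}{\epsilon}$ for some constant $D_f$, for any $0<\epsilon\le 1$. Consider the following algorithm: pick an arbitrary starting point $x_0\in D$; for $k=0,1,2,\dots$, let $\alpha_k:=\frac{2}{k+2}$ and $\epsilon_k:=\sqrt{\alpha_k}$, compute $s_k\in D$ such that $$\max_{d\in T(x_k,\epsilon_k)}\langle s_k-x_k,d\rangle\le \min_{z\in D}\ \max_{d\in T(x_k,\epsilon_k)}\langle z-x_k,d\rangle,$$ and update $x_{k+1}:=x_k+\alpha_k(s_k-x_k)$. Then this algorithm generates a sequence of iterates $x_k$ such that for the $k$-th iteration $$f(x_k)-f(x_* )\le \frac{2^{5/2}L+2^{3/2}D_f}{\sqrt{k+2}},$$ where $x_*$ is the optimal solution of the problem $\min_{x\in D}f(x)$.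
   Context: Here $\partial f(x)$ denotes the convex subdifferential of $f$ at $x$. Let $N$ be an arbitrary fixed mapping assigning to each point $x$ and each $\epsilon>0$ a neighborhood $N(x,\epsilon)$ around $x$ with $x\in N(x,\epsilon)\subseteq\mathcal{B}(x,\epsilon)$, where $\mathcal{B}(x,r)$ is the open ball of radius $r$ around $x$. The approximate subdifferential is $$T(x,\epsilon):=\begin{cases}\{\nabla f(x)\} & \text{if } f \text{ is differentiable on } N(x,\epsilon),\\ \bigcup_{u\in N(x,\epsilon)}\partial f(u) & \text{otherwise.}\end{cases}$$ The generalized curvature constant is $$C_f(\epsilon):=\sup_{\substack{x,s\in D,\ \alpha\in(0,1]\\ y=x+\alpha(s-x)}}\ \min_{d\in T(x,\epsilon)}\frac{1}{\alpha^2}\bigl(f(y)-f(x)-\langle y-x,d\rangle\bigr).$$ Max and min over $T(x,\epsilon)$ are read as sup and inf if not attained.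
   Formalization: The bound is stated for k ≥ 1 (it fails at k = 0 for f(x) = x on [0,10], x_0 = 10), and f is defined and L-Lipschitz on an open set containing D, with subdifferentials relative to that set, since N(x,ε) may leave D and the claim fails for f on D alone. *)

theory Defs
  imports "HOL-Analysis.Analysis"
begin

(* Throughout, X is the domain on which f is a function; values of f outside X are irrelevant. *)

(* Convex subdifferential of f : X -> R, empty outside the domain X. *)
definition subdifferential :: "'a::real_inner set \<Rightarrow> ('a \<Rightarrow> real) \<Rightarrow> 'a \<Rightarrow> 'a set" where
  "subdifferential X f u = {d. u \<in> X \<and> (\<forall>y\<in>X. f u + d \<bullet> (y - u) \<le> f y)}"

(* Meaningful only where f is differentiable. *)
definition gradient :: "('a::real_inner \<Rightarrow> real) \<Rightarrow> 'a \<Rightarrow> 'a" where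
  "gradient f x = (THE d. GDERIV f x :> d)"

definition neighborhood_map :: "('a::metric_space \<Rightarrow> real \<Rightarrow> 'a set) \<Rightarrow> bool" where
  "neighborhood_map N \<longleftrightarrow> (\<forall>x. \<forall>\<epsilon>>0. x \<in> interior (N x \<epsilon>) \<and> N x \<epsilon> \<subseteq> ball x \<epsilon>)"

(* A neighbourhood may leave X; f is not differentiable at points outside its domain. *)
definition approx_subdifferential ::
  "'a::euclidean_space set \<Rightarrow> ('a \<Rightarrow> real) \<Rightarrow> ('a \<Rightarrow> real \<Rightarrow> 'a set) \<Rightarrow> 'a \<Rightarrow> real \<Rightarrow> 'a set" where
  "approx_subdifferential X f N x \<epsilon> =
     (if \<forall>u\<in>N x \<epsilon>. u \<in> X \<and> f differentiable (at u) then {gradient f x}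
      else (\<Union>u\<in>N x \<epsilon>. subdifferential X f u))"

(* Extended-real valued, so that the supremum and infimum always exist and an
   upper bound by a real number really says that the supremum is finite. *)
definition curvature_constant ::
  "'a::euclidean_space set \<Rightarrow> ('a \<Rightarrow> real) \<Rightarrow> 'a set \<Rightarrow> ('a \<Rightarrow> real \<Rightarrow> 'a set) \<Rightarrow> real \<Rightarrow> ereal" where
  "curvature_constant X f D N \<epsilon> =
     (SUP (x, s, \<alpha>) \<in> D \<times> D \<times> {0<..1}.
        let y = x + \<alpha> *\<^sub>R (s - x) in
        INF d \<in> approx_subdifferential X f N x \<epsilon>.
          ereal (1 / \<alpha>\<^sup>2 * (f y - f x - (y - x) \<bullet> d)))"

end

theory Submission
  imports Defs
begin

text \<open>
  The argument is that of the Frank--Wolfe method, with the linearisation of \<open>f\<close> at the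
  current iterate taken along an approximate subgradient. Write \<open>h k\<close> for
  the gap \<open>f (x k) - f xopt\<close>, and omit the index \<open>k\<close> within a single step.

  A single step is controlled from two sides. The curvature bound provides some
  \<open>d\<close> in the approximate subdifferential for which \<open>f\<close> grows along the step by at most
  \<open>\<alpha> * ((s - x) \<bullet> d) + \<alpha>\<^sup>2 * D\<^sub>f / \<epsilon>\<close>, up to an arbitrarily small slack. It does not say which \<open>d\<close> this is, and that is why
  \<open>s\<close> minimises the worst case over all \<open>d\<close>: comparing \<open>s\<close> with the competitor \<open>xopt\<close>
  bounds \<open>(s - x) \<bullet> d\<close> by the largest value of \<open>(xopt - x) \<bullet> d\<close> over the approximate
  subdifferential. Such a \<open>d\<close> is either the gradient at \<open>x\<close>, for which convexity gives
  \<open>(xopt - x) \<bullet> d \<le> - h\<close>, or a subgradient at a point \<open>u\<close> within \<open>\<epsilon>\<close> of \<open>x\<close>. In the second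
  case \<open>x\<close> may be replaced by \<open>u\<close> at a cost of \<open>2 * L * \<epsilon>\<close>, one \<open>L * \<epsilon>\<close> for \<open>f\<close> itself and
  one for the linear term, because subgradients of an \<open>L\<close>-Lipschitz function have norm at
  most \<open>L\<close> (lemma \<open>inner_approx_subdifferential_le\<close>). Together,
  \<open>h (Suc k) \<le> (1 - \<alpha> k) * h k + 2 * L * \<alpha> k * \<epsilon> k + (\<alpha> k)\<^sup>2 * D\<^sub>f / \<epsilon> k\<close>,
  which is lemma \<open>frank_wolfe_step\<close>. The choice \<open>\<epsilon> = sqrt \<alpha>\<close> balances the two error terms:
  both become multiples of \<open>\<alpha> * sqrt \<alpha>\<close>, with total constant \<open>2 * L + D\<^sub>f\<close>. The recurrence is
  then solved by induction in lemma \<open>frank_wolfe_recurrence\<close>.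
\<close>

section \<open>Linear bounds from approximate subgradients\<close>

text \<open>Moving from \<open>u\<close> a little way in the direction \<open>d\<close> itself, which the openness of
  \<open>X\<close> permits, makes \<open>f\<close> grow at rate at least \<open>norm d\<close>.\<close>

lemma norm_subgradient_le_lipschitz:
  fixes f :: "'a::real_inner \<Rightarrow> real"
  assumes "open X" and lip: "L-lipschitz_on X f" and d: "d \<in> subdifferential X f u"
  shows "norm d \<le> L"
proof (cases "d = 0")
  case True
  then show ?thesis using lipschitz_on_nonneg[OF lip] by simp
next
  case False
  have u: "u \<in> X" and sub: "\<And>y. y \<in> X \<Longrightarrow> f u + d \<bullet> (y - u) \<le> f y"
    using d by (auto simp: subdifferential_def)
  obtain r where r: "r > 0" "cball u r \<subseteq> X"
    using \<open>open X\<close> u open_contains_cball by blast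
  define t where "t = r / norm d"
  have t: "t > 0" using r False by (simp add: t_def)
  define y where "y = u + t *\<^sub>R d"
  have y: "y \<in> X"
    using r False by (intro subsetD[OF r(2)]) (simp add: y_def t_def dist_norm)
  have "t * (norm d * norm d) = d \<bullet> (y - u)"
    by (simp add: y_def dot_square_norm power2_eq_square)
  also have "\<dots> \<le> f y - f u" using sub[OF y] by simp
  also have "\<dots> \<le> dist (f y) (f u)" by (simp add: dist_real_def)
  also have "\<dots> \<le> L * dist y u" by (rule lipschitz_onD[OF lip y u])
  also have "\<dots> = t * (L * norm d)" using t by (simp add: y_def dist_norm)
  finally have "t * (norm d * norm d) \<le> t * (L * norm d)" .
  then show ?thesis using t False by simp
qed

lemma GDERIV_gradient:
  fixes f :: "'a::euclidean_space \<Rightarrow> real"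
  assumes "f differentiable (at x)"
  shows "GDERIV f x :> gradient f x"
proof -
  obtain f' where f': "(f has_derivative f') (at x)"
    using assms by (auto simp: differentiable_def)
  interpret f': bounded_linear f' using f' by (rule has_derivative_bounded_linear)
  define d where "d = (\<Sum>b\<in>Basis. f' b *\<^sub>R b)"
  have "f' h = h \<bullet> d" for h
  proof -
    have "f' h = f' (\<Sum>b\<in>Basis. (h \<bullet> b) *\<^sub>R b)" by (simp add: euclidean_representation)
    also have "\<dots> = h \<bullet> d"
      by (simp add: d_def f'.sum f'.scaleR inner_sum_right mult.commute)
    finally show ?thesis .
  qed
  then have "f' = (\<lambda>h. h \<bullet> d)" by blast
  then have "GDERIV f x :> d" using f' by (simp add: gderiv_def)
  moreover have "e = d" if "GDERIV f x :> e" for e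
  proof -
    have "(\<lambda>h. h \<bullet> e) = (\<lambda>h. h \<bullet> d)"
      using that \<open>GDERIV f x :> d\<close> unfolding gderiv_def by (rule has_derivative_unique)
    then show ?thesis unfolding fun_eq_iff by (simp only: vector_eq_ldot)
  qed
  ultimately show ?thesis unfolding gradient_def by (rule theI[of "\<lambda>d. GDERIV f x :> d"])
qed

text \<open>The point \<open>x\<close> may lie on the boundary of the convex set \<open>D\<close>, and \<open>f\<close> is convex on
  \<open>D\<close> only. The difference quotients from the side of \<open>z\<close> are therefore used: convexity
  bounds each of them by \<open>f z - f x\<close>, and they converge to the directional derivative.\<close>

lemma convex_on_above_GDERIV:
  fixes f :: "'a::real_inner \<Rightarrow> real"
  assumes conv: "convex_on D f" and x: "x \<in> D" and z: "z \<in> D" and d: "GDERIV f x :> d"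
  shows "(z - x) \<bullet> d \<le> f z - f x"
proof -
  define g where "g t = f (x + t *\<^sub>R (z - x))" for t :: real
  have "(g has_derivative (\<lambda>t. (t *\<^sub>R (z - x)) \<bullet> d)) (at 0)"
    unfolding g_def using d unfolding gderiv_def
    by (intro has_derivative_compose[where f = "\<lambda>t. x + t *\<^sub>R (z - x)" and g = f])
       (auto intro!: derivative_eq_intros)
  then have "(g has_real_derivative (z - x) \<bullet> d) (at 0)"
    by (simp add: has_field_derivative_def mult.commute[of _ "(z - x) \<bullet> d"])
  then have "((\<lambda>t. (g t - g 0) / t) \<longlongrightarrow> (z - x) \<bullet> d) (at 0)"
    by (simp add: has_field_derivative_iff)
  then have lim: "((\<lambda>t. (g t - g 0) / t) \<longlongrightarrow> (z - x) \<bullet> d) (at_right 0)"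
    by (rule filterlim_mono) (auto simp: at_le)
  have "(g t - g 0) / t \<le> f z - f x" if "0 < t" "t < 1" for t
  proof -
    have "g t = f ((1 - t) *\<^sub>R x + t *\<^sub>R z)" by (simp add: g_def algebra_simps)
    also have "\<dots> \<le> (1 - t) * f x + t * f z"
      using that x z by (intro convex_onD[OF conv]) auto
    finally have "g t - g 0 \<le> t * (f z - f x)" by (simp add: g_def algebra_simps)
    then show ?thesis using that by (simp add: divide_le_eq mult.commute)
  qed
  then have "eventually (\<lambda>t. (g t - g 0) / t \<le> f z - f x) (at_right 0)"
    by (intro eventually_at_rightI[of 0 1]) auto
  with lim show ?thesis by (rule tendsto_upperbound) simp
qed

text \<open>One \<open>L * \<epsilon>\<close> pays for evaluating \<open>f\<close> at a nearby point \<open>u\<close> instead of \<open>x\<close>, the other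
  for measuring the linear term from \<open>u\<close>.\<close>

lemma inner_approx_subdifferential_le:
  fixes f :: "'a::euclidean_space \<Rightarrow> real"
  assumes "open X" "D \<subseteq> X" and conv: "convex_on D f" and lip: "L-lipschitz_on X f"
    and N: "neighborhood_map N" and "\<epsilon> > 0" and x: "x \<in> D" and z: "z \<in> D"
    and d: "d \<in> approx_subdifferential X f N x \<epsilon>"
  shows "(z - x) \<bullet> d \<le> f z - f x + 2 * L * \<epsilon>"
proof -
  have L: "L \<ge> 0" using lip by (rule lipschitz_on_nonneg)
  have N_x: "x \<in> N x \<epsilon>" "N x \<epsilon> \<subseteq> ball x \<epsilon>"
    using N \<open>\<epsilon> > 0\<close> interior_subset unfolding neighborhood_map_def by blast+
  show ?thesis
  proof (cases "\<forall>u\<in>N x \<epsilon>. u \<in> X \<and> f differentiable (at u)")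
    case True
    then have "d = gradient f x" using d by (simp add: approx_subdifferential_def)
    then have "(z - x) \<bullet> d \<le> f z - f x"
      using convex_on_above_GDERIV[OF conv x z] GDERIV_gradient True N_x by blast
    moreover have "0 \<le> 2 * L * \<epsilon>" using L \<open>\<epsilon> > 0\<close> by simp
    ultimately show ?thesis by linarith
  next
    case False
    then obtain u where u: "u \<in> N x \<epsilon>" and du: "d \<in> subdifferential X f u"
      using d unfolding approx_subdifferential_def if_not_P[OF False] by blast
    have uX: "u \<in> X" and sub: "\<And>y. y \<in> X \<Longrightarrow> f u + d \<bullet> (y - u) \<le> f y"
      using du by (auto simp: subdifferential_def)
    have dist: "dist x u \<le> \<epsilon>" using u N_x by auto
    have "f x - f u \<le> dist (f x) (f u)" by (simp add: dist_real_def)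
    also have "\<dots> \<le> L * dist x u" using x \<open>D \<subseteq> X\<close> by (intro lipschitz_onD[OF lip] uX) auto
    also have "\<dots> \<le> L * \<epsilon>" using dist L by (rule mult_left_mono)
    finally have f_close: "f x - f u \<le> L * \<epsilon>" .
    have "(u - x) \<bullet> d \<le> norm (u - x) * norm d" by (rule norm_cauchy_schwarz)
    also have "\<dots> \<le> \<epsilon> * L"
      using dist \<open>\<epsilon> > 0\<close> norm_subgradient_le_lipschitz[OF \<open>open X\<close> lip du]
      by (intro mult_mono) (auto simp: dist_norm norm_minus_commute)
    finally have inner_close: "(u - x) \<bullet> d \<le> \<epsilon> * L" .
    have "(z - x) \<bullet> d = d \<bullet> (z - u) + (u - x) \<bullet> d"
      by (simp add: inner_diff_left inner_diff_right inner_commute)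
    moreover have "f u + d \<bullet> (z - u) \<le> f z" using sub z \<open>D \<subseteq> X\<close> by blast
    ultimately show ?thesis using f_close inner_close by (simp add: algebra_simps)
  qed
qed

section \<open>One step and the resulting recurrence\<close>

text \<open>The infimum in the curvature constant need not be attained, so \<open>d\<close> is chosen within a
  slack \<open>\<delta>\<close> of it. Such a \<open>d\<close> exists even though the definition permits an empty
  approximate subdifferential: the infimum would then be \<open>\<infinity>\<close>, against the finite
  bound \<open>B\<close>.\<close>

lemma curvature_constant_approx_subgradient:
  assumes "curvature_constant X f D N \<epsilon> \<le> ereal B" "x \<in> D" "s \<in> D" "0 < \<alpha>" "\<alpha> \<le> 1" "\<delta> > 0"
  obtains d where "d \<in> approx_subdifferential X f N x \<epsilon>"
    "f (x + \<alpha> *\<^sub>R (s - x)) \<le> f x + \<alpha> * ((s - x) \<bullet> d) + \<alpha>\<^sup>2 * (B + \<delta>)"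
proof -
  have "(INF d \<in> approx_subdifferential X f N x \<epsilon>.
      ereal (1 / \<alpha>\<^sup>2 * (f (x + \<alpha> *\<^sub>R (s - x)) - f x - (\<alpha> *\<^sub>R (s - x)) \<bullet> d)))
      \<le> curvature_constant X f D N \<epsilon>"
    unfolding curvature_constant_def Let_def
    by (rule SUP_upper2[of "(x, s, \<alpha>)"]) (use assms in auto)
  also have "\<dots> < ereal (B + \<delta>)"
    using assms by (intro le_less_trans[OF assms(1)]) simp
  finally obtain d where d: "d \<in> approx_subdifferential X f N x \<epsilon>"
    and lt: "1 / \<alpha>\<^sup>2 * (f (x + \<alpha> *\<^sub>R (s - x)) - f x - (\<alpha> *\<^sub>R (s - x)) \<bullet> d) < B + \<delta>"
    by (auto simp: INF_less_iff)
  have "f (x + \<alpha> *\<^sub>R (s - x)) - f x - (\<alpha> *\<^sub>R (s - x)) \<bullet> d \<le> \<alpha>\<^sup>2 * (B + \<delta>)"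
    using lt \<open>0 < \<alpha>\<close> by (simp add: divide_less_eq mult.commute)
  then show ?thesis by (intro that[OF d]) simp
qed

text \<open>The optimality of \<open>s\<close> makes \<open>(s - x) \<bullet> d\<close> small for all \<open>d\<close> at once, in particular
  for the one chosen from the curvature bound; the slack in that choice then tends to \<open>0\<close>.\<close>

lemma frank_wolfe_step:
  fixes f :: "'a::euclidean_space \<Rightarrow> real"
  assumes "open X" "D \<subseteq> X" "convex_on D f" "L-lipschitz_on X f" "neighborhood_map N"
    and curv: "curvature_constant X f D N \<epsilon> \<le> ereal B"
    and "0 < \<epsilon>" "0 < \<alpha>" "\<alpha> \<le> 1" "x \<in> D" "s \<in> D" "z \<in> D"
    and s_opt: "(SUP d \<in> approx_subdifferential X f N x \<epsilon>. ereal ((s - x) \<bullet> d))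
        \<le> (INF z \<in> D. SUP d \<in> approx_subdifferential X f N x \<epsilon>. ereal ((z - x) \<bullet> d))"
  shows "f (x + \<alpha> *\<^sub>R (s - x)) - f z
    \<le> (1 - \<alpha>) * (f x - f z) + 2 * L * \<alpha> * \<epsilon> + \<alpha>\<^sup>2 * B"
proof -
  let ?T = "approx_subdifferential X f N x \<epsilon>"
  have lin: "(s - x) \<bullet> d \<le> f z - f x + 2 * L * \<epsilon>" if "d \<in> ?T" for d
  proof -
    have "ereal ((s - x) \<bullet> d) \<le> (SUP d \<in> ?T. ereal ((s - x) \<bullet> d))"
      using that by (rule SUP_upper)
    also have "\<dots> \<le> (INF z \<in> D. SUP d \<in> ?T. ereal ((z - x) \<bullet> d))" by (rule s_opt)
    also have "\<dots> \<le> (SUP d \<in> ?T. ereal ((z - x) \<bullet> d))"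
      using \<open>z \<in> D\<close> by (rule INF_lower)
    also have "\<dots> \<le> ereal (f z - f x + 2 * L * \<epsilon>)"
      using assms by (auto intro!: SUP_least inner_approx_subdifferential_le)
    finally show ?thesis by simp
  qed
  have slack: "f (x + \<alpha> *\<^sub>R (s - x)) - f z
    \<le> (1 - \<alpha>) * (f x - f z) + 2 * L * \<alpha> * \<epsilon> + \<alpha>\<^sup>2 * B + \<alpha>\<^sup>2 * \<delta>" if \<delta>: "\<delta> > 0" for \<delta>
  proof -
    obtain d where "d \<in> ?T"
      and d: "f (x + \<alpha> *\<^sub>R (s - x)) \<le> f x + \<alpha> * ((s - x) \<bullet> d) + \<alpha>\<^sup>2 * (B + \<delta>)"
      by (rule curvature_constant_approx_subgradient[OF curv \<open>x \<in> D\<close> \<open>s \<in> D\<close> \<open>0 < \<alpha>\<close> \<open>\<alpha> \<le> 1\<close> \<delta>])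
    have "\<alpha> * ((s - x) \<bullet> d) \<le> \<alpha> * (f z - f x + 2 * L * \<epsilon>)"
      using lin[OF \<open>d \<in> ?T\<close>] \<open>0 < \<alpha>\<close> by simp
    with d show ?thesis by (simp add: algebra_simps)
  qed
  show ?thesis
  proof (rule field_le_epsilon)
    fix e :: real assume "e > 0"
    then show "f (x + \<alpha> *\<^sub>R (s - x)) - f z
      \<le> (1 - \<alpha>) * (f x - f z) + 2 * L * \<alpha> * \<epsilon> + \<alpha>\<^sup>2 * B + e"
      using slack[of "e / \<alpha>\<^sup>2"] \<open>0 < \<alpha>\<close> by simp
  qed
qed

text \<open>Since \<open>\<alpha> 0 = 1\<close>, the first step discards \<open>h 0\<close> and gives \<open>h 1 \<le> C\<close>; with
  \<open>h 1 \<ge> 0\<close> this also shows \<open>C \<ge> 0\<close>. In the induction step the claim for \<open>n = k + 2\<close> reduces to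
  \<open>(n - 1) / (n * sqrt n) \<le> 1 / sqrt (n + 1)\<close>, which after squaring says
  \<open>(n - 1)\<^sup>2 * (n + 1) \<le> n ^ 3\<close>.\<close>

lemma frank_wolfe_recurrence:
  fixes h \<alpha> :: "nat \<Rightarrow> real"
  assumes \<alpha>: "\<And>k. \<alpha> k = 2 / (real k + 2)" and nonneg: "\<And>k. h k \<ge> 0"
    and rec: "\<And>k. h (Suc k) \<le> (1 - \<alpha> k) * h k + C * (\<alpha> k * sqrt (\<alpha> k))"
    and "k \<ge> 1"
  shows "h k \<le> 2 * sqrt 2 * C / sqrt (real k + 2)"
  using \<open>k \<ge> 1\<close>
proof (induction k rule: dec_induct)
  case base
  have h1: "h 1 \<le> C" using rec[of 0] by (simp add: \<alpha>)
  then have "C \<ge> 0" using nonneg[of 1] by linarith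
  have "sqrt 3 \<le> sqrt 8" by simp
  also have "sqrt 8 = 2 * sqrt (2::real)" using real_sqrt_mult[of 4 2] by simp
  finally have "C * sqrt 3 \<le> C * (2 * sqrt 2)" using \<open>C \<ge> 0\<close> by (rule mult_left_mono)
  then have "C \<le> 2 * sqrt 2 * C / sqrt 3" by (simp add: le_divide_eq mult.commute)
  then show ?case using h1 by simp
next
  case (step k)
  have "C \<ge> 0" using rec[of 0] nonneg[of 1] by (simp add: \<alpha>)
  define n where "n = real k + 2"
  have n: "n \<ge> 2" by (simp add: n_def)
  have "h (Suc k) \<le> (1 - 2 / n) * h k + C * (2 / n * sqrt (2 / n))"
    using rec[of k] by (simp add: \<alpha> n_def)
  also have "\<dots> \<le> (1 - 2 / n) * (2 * sqrt 2 * C / sqrt n) + C * (2 / n * sqrt (2 / n))"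
    using step.IH n by (intro add_right_mono mult_left_mono) (auto simp: n_def)
  also have "\<dots> = 2 * sqrt 2 * C * ((n - 1) / (n * sqrt n))"
    using n by (simp add: real_sqrt_divide field_simps)
  also have "\<dots> \<le> 2 * sqrt 2 * C * (1 / sqrt (n + 1))"
  proof (intro mult_left_mono)
    have "(n - 1) * sqrt (n + 1) = sqrt ((n - 1)\<^sup>2 * (n + 1))"
      using n by (simp add: real_sqrt_mult)
    also have "\<dots> \<le> sqrt (n\<^sup>2 * n)"
    proof (rule real_sqrt_le_mono)
      have "n\<^sup>2 * n - (n - 1)\<^sup>2 * (n + 1) = n * n + n - 1"
        by (simp add: power2_eq_square algebra_simps)
      moreover have "n * n \<ge> 0" by simp
      ultimately show "(n - 1)\<^sup>2 * (n + 1) \<le> n\<^sup>2 * n" using n by linarith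
    qed
    also have "\<dots> = n * sqrt n" using n by (simp add: real_sqrt_mult)
    finally show "(n - 1) / (n * sqrt n) \<le> 1 / sqrt (n + 1)"
      using n by (simp add: divide_simps)
  qed (use \<open>C \<ge> 0\<close> in simp)
  finally show ?case by (simp add: n_def add.commute add.left_commute)
qed

section \<open>The rate of convergence\<close>

theorem theorem1:
  fixes X D :: "'a::euclidean_space set" and f :: "'a \<Rightarrow> real"
    and N :: "'a \<Rightarrow> real \<Rightarrow> 'a set" and L D\<^sub>f :: real
    and \<alpha> \<epsilon> :: "nat \<Rightarrow> real" and x s :: "nat \<Rightarrow> 'a" and xopt :: 'a
  assumes domain: "open X" "D \<subseteq> X"
    and D: "compact D" "convex D"
    and f: "convex_on D f" "continuous_on D f"
    and lipschitz: "L-lipschitz_on X f"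
    and N: "neighborhood_map N"
    and curvature: "\<And>e. 0 < e \<Longrightarrow> e \<le> 1 \<Longrightarrow> curvature_constant X f D N e \<le> ereal (D\<^sub>f / e)"
    and step: "\<And>k. \<alpha> k = 2 / (real k + 2)"
    and eps: "\<And>k. \<epsilon> k = sqrt (\<alpha> k)"
    and start: "x 0 \<in> D"
    and s_in_D: "\<And>k. s k \<in> D"
    and s_opt: "\<And>k. (SUP d \<in> approx_subdifferential X f N (x k) (\<epsilon> k). ereal ((s k - x k) \<bullet> d))
        \<le> (INF z \<in> D. SUP d \<in> approx_subdifferential X f N (x k) (\<epsilon> k). ereal ((z - x k) \<bullet> d))"
    and update: "\<And>k. x (Suc k) = x k + \<alpha> k *\<^sub>R (s k - x k)"
    and optimal: "is_arg_min f (\<lambda>z. z \<in> D) xopt"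
  shows "\<forall>k\<ge>1. f (x k) - f xopt \<le> (2 powr (5/2) * L + 2 powr (3/2) * D\<^sub>f) / sqrt (real k + 2)"
proof (intro allI impI)
  fix k :: nat assume "k \<ge> 1"
  have \<alpha>: "0 < \<alpha> k" "\<alpha> k \<le> 1" for k by (simp_all add: step)
  have \<epsilon>: "0 < \<epsilon> k" "\<epsilon> k \<le> 1" for k using \<alpha>[of k] by (simp_all add: eps)
  have xD: "x k \<in> D" for k
  proof (induction k)
    case (Suc k)
    have "x (Suc k) = (1 - \<alpha> k) *\<^sub>R x k + \<alpha> k *\<^sub>R s k"
      by (simp add: update algebra_simps)
    then show ?case using D(2) Suc s_in_D[of k] \<alpha>[of k] by (simp add: convexD_alt)
  qed (rule start)
  have xopt: "xopt \<in> D" "\<And>z. z \<in> D \<Longrightarrow> f xopt \<le> f z"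
    using optimal by (auto simp: is_arg_min_linorder)
  define h where "h k = f (x k) - f xopt" for k
  have rec: "h (Suc k) \<le> (1 - \<alpha> k) * h k + (2 * L + D\<^sub>f) * (\<alpha> k * sqrt (\<alpha> k))" for k
  proof -
    have "h (Suc k) \<le> (1 - \<alpha> k) * h k + 2 * L * \<alpha> k * \<epsilon> k + (\<alpha> k)\<^sup>2 * (D\<^sub>f / \<epsilon> k)"
      unfolding h_def update
      by (rule frank_wolfe_step[OF domain f(1) lipschitz N curvature[OF \<epsilon>] \<epsilon>(1) \<alpha> xD s_in_D
            xopt(1) s_opt])
    \<comment> \<open>The choice of \<open>\<epsilon>\<close> gives both error terms the same order.\<close>
    moreover have "(\<alpha> k)\<^sup>2 * (D\<^sub>f / \<epsilon> k) = D\<^sub>f * (\<alpha> k * sqrt (\<alpha> k))"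
      using \<alpha>[of k] by (simp add: eps power2_eq_square field_simps)
    ultimately show ?thesis by (simp add: eps algebra_simps)
  qed
  have "h k \<le> 2 * sqrt 2 * (2 * L + D\<^sub>f) / sqrt (real k + 2)"
  proof (rule frank_wolfe_recurrence[where h = h, OF step _ rec \<open>k \<ge> 1\<close>])
    show "h k \<ge> 0" for k using xopt(2)[OF xD] by (simp add: h_def)
  qed
  moreover have "2 powr (3/2) = 2 * sqrt (2::real)"
    using powr_add[of 2 1 "1/2::real"] by (simp add: powr_half_sqrt)
  moreover have "2 powr (5/2) = 4 * sqrt (2::real)"
    using powr_add[of 2 2 "1/2::real"] by (simp add: powr_half_sqrt)
  ultimately show "f (x k) - f xopt \<le> (2 powr (5/2) * L + 2 powr (3/2) * D\<^sub>f) / sqrt (real k + 2)"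
    by (simp add: h_def algebra_simps)
qed

end
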